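(* Let $1\le n\le N$ and let $k$ be a constant symmetric real $n\times n$ matrix. The space $$W^k_{n,N}=\{(Q,P)\in\mathbb R^{nN}\times\mathbb R^{nN}:\ QQ^{\mathsf T}=I_n,\ QP^{\mathsf T}+PQ^{\mathsf T}=k\}$$ is a symplectic submanifold of $W_{n,N}=(\mathbb R^{nN}\times\mathbb R^{nN},\omega)$, where $$\omega\big((A_1,A_2),(B_1,B_2)\big)=\langle A_1,B_2\rangle-\langle A_2,B_1\rangle .$$
   Context: $\mathbb R^{nN}$ denotes the real $n\times N$ matrices, and $\langle A,B\rangle=\operatorname{Tr}(A^{\mathsf T}B)$. *)

theory Defs
  imports "HOL-Analysis.Analysis"
begin

text \<open>Both predicates below are meant for open \<open>U\<close>. In finite dimensions, \<open>C\<close>-\<open>k\<close> regularity of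
  the derivative is the same as \<open>C\<close>-\<open>k\<close> regularity of all its directional evaluations, which keeps
  the recursion inside one function type.\<close>

primrec Ck_on :: "nat \<Rightarrow> 'a set \<Rightarrow> ('a::euclidean_space \<Rightarrow> 'b::euclidean_space) \<Rightarrow> bool" where
  "Ck_on 0 U f \<longleftrightarrow> continuous_on U f"
| "Ck_on (Suc k) U f \<longleftrightarrow>
     (\<forall>x\<in>U. f differentiable (at x)) \<and>
     (\<forall>v. Ck_on k U (\<lambda>x. frechet_derivative f (at x) v))"

definition smooth_on :: "'a set \<Rightarrow> ('a::euclidean_space \<Rightarrow> 'b::euclidean_space) \<Rightarrow> bool" where
  "smooth_on U f \<longleftrightarrow> (\<forall>k. Ck_on k U f)"

definition diffeomorphism ::
  "'a set \<Rightarrow> 'b set \<Rightarrow> ('a::euclidean_space \<Rightarrow> 'b::euclidean_space) \<Rightarrow> ('b \<Rightarrow> 'a) \<Rightarrow> bool" where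
  "diffeomorphism U V f g \<longleftrightarrow>
     open U \<and> open V \<and> homeomorphism U V f g \<and> smooth_on U f \<and> smooth_on V g"

text \<open>Embedded submanifolds of a Euclidean space (without boundary, of constant dimension \<open>d\<close>), by
  slice charts. The convention that manifolds are nonempty is adopted.\<close>

definition smooth_submanifold :: "nat \<Rightarrow> 'a::euclidean_space set \<Rightarrow> bool" where
  "smooth_submanifold d S \<longleftrightarrow>
     S \<noteq> {} \<and>
     (\<forall>p\<in>S. \<exists>U V (f :: 'a \<Rightarrow> 'a) g L.
        p \<in> U \<and> diffeomorphism U V f g \<and> subspace L \<and> dim L = d \<and> f ` (U \<inter> S) = V \<inter> L)"

definition tangent_space :: "'a::euclidean_space set \<Rightarrow> 'a \<Rightarrow> 'a set" where
  "tangent_space S p =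
     {v. \<exists>(c :: real \<Rightarrow> 'a) e. e > 0 \<and> smooth_on {-e<..<e} c \<and> c ` {-e<..<e} \<subseteq> S \<and>
           c 0 = p \<and> (c has_vector_derivative v) (at 0)}"

definition nondegenerate_on :: "'a::real_vector set \<Rightarrow> ('a \<Rightarrow> 'a \<Rightarrow> real) \<Rightarrow> bool" where
  "nondegenerate_on T w \<longleftrightarrow> (\<forall>u\<in>T. (\<forall>v\<in>T. w u v = 0) \<longrightarrow> u = 0)"

definition symplectic_form :: "('a::real_vector \<Rightarrow> 'a \<Rightarrow> real) \<Rightarrow> bool" where
  "symplectic_form w \<longleftrightarrow> bilinear w \<and> (\<forall>u. w u u = 0) \<and> nondegenerate_on UNIV w"

text \<open>The ambient manifold is a vector space carrying the constant-coefficient 2-form \<open>w\<close>. Such a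
  form is closed, and so is its pullback to any submanifold; hence the pullback is symplectic exactly
  when it is nondegenerate on every tangent space.\<close>

definition symplectic_submanifold ::
  "('a::euclidean_space \<Rightarrow> 'a \<Rightarrow> real) \<Rightarrow> 'a set \<Rightarrow> bool" where
  "symplectic_submanifold w S \<longleftrightarrow>
     symplectic_form w \<and> (\<exists>d. smooth_submanifold d S) \<and>
     (\<forall>p\<in>S. nondegenerate_on (tangent_space S p) w)"

text \<open>The type \<open>real^'m^'n\<close> consists of matrices with rows indexed by \<open>'n\<close> and columns by \<open>'m\<close>;
  \<open>n\<close> and \<open>N\<close> are \<open>CARD('n)\<close> and \<open>CARD('m)\<close>.\<close>

definition frob_inner :: "real^'m^'n \<Rightarrow> real^'m^'n \<Rightarrow> real" where
  "frob_inner A B = trace (transpose A ** B)"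

definition omega :: "(real^'m^'n) \<times> (real^'m^'n) \<Rightarrow> (real^'m^'n) \<times> (real^'m^'n) \<Rightarrow> real" where
  "omega A B = frob_inner (fst A) (snd B) - frob_inner (snd A) (fst B)"

definition W_space :: "real^'n^'n \<Rightarrow> ((real^'m^'n) \<times> (real^'m^'n)) set" where
  "W_space k = {(Q, P). Q ** transpose Q = mat 1 \<and> Q ** transpose P + P ** transpose Q = k}"

end

theory Submission
  imports Defs
begin

text \<open>Fix a point \<open>(Q\<^sub>0, P\<^sub>0)\<close> and write \<open>Q = a Q\<^sub>0 + b\<close> with \<open>b Q\<^sub>0\<^sup>T = 0\<close>. A generalized Cayley
  transform linearizes the first constraint: with \<open>c = (1 + a)\<^sup>-\<^sup>1\<close> and \<open>y = c b\<close> one has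
  \<open>c + c\<^sup>T - 1 - y y\<^sup>T = - c (Q Q\<^sup>T - 1) c\<^sup>T\<close>, so \<open>Q Q\<^sup>T = 1\<close> says that \<open>c - (1 + y y\<^sup>T) / 2\<close> is skew.
  If \<open>M\<close> depends on \<open>Q\<close> so that \<open>Q = Q\<^sub>0 M\<close>, the second constraint is affine in \<open>P M\<^sup>T\<close>. Both
  substitutions are rational with rational inverses, which gives slice charts; the dimension of the
  slices is constant by rank-nullity, since the linearized constraint map has all pairs of symmetric
  matrices as its range.

  Tangent vectors are exactly the kernel of the differentiated constraints, as seen from curves
  \<open>(Q\<^sub>0 R(t), (P\<^sub>0 + t B) R(t))\<close> with \<open>R(t)\<close> orthogonal. The Hamiltonian vector fields of the constraints
  are \<open>(R Q, - (S Q + R P))\<close> for symmetric \<open>R\<close> and \<open>S\<close>; they are \<open>omega\<close>-orthogonal to the tangent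
  space and together with it span the whole space, so \<open>omega\<close> is nondegenerate on the tangent
  space.\<close>

subsection \<open>Calculus of smooth maps\<close>

text \<open>Since \<open>U\<close> is open, functions that agree on \<open>U\<close> have the same
  derivative at each of its points, so the agreement passes down the recursion.\<close>

lemma Ck_on_cong:
  assumes U: "open U" and "Ck_on k U f" "\<And>x. x \<in> U \<Longrightarrow> f x = g x"
  shows "Ck_on k U g"
  using assms(2-)
proof (induction k arbitrary: f g)
  case 0
  then show ?case by (simp cong: continuous_on_cong)
next
  case (Suc k)
  have D: "(g has_derivative frechet_derivative f (at x)) (at x)" if "x \<in> U" for x
    using Suc.prems that U
    by (auto simp: frechet_derivative_works intro: has_derivative_transform_within_open)
  then have *: "frechet_derivative g (at x) = frechet_derivative f (at x)" if "x \<in> U" for x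
    using that by (metis frechet_derivative_at)
  show ?case
    unfolding Ck_on.simps
  proof (intro conjI ballI allI)
    show "g differentiable at x" if "x \<in> U" for x
      using D[OF that] by (auto simp: differentiable_def)
    show "Ck_on k U (\<lambda>x. frechet_derivative g (at x) v)" for v
      by (rule Suc.IH[where f = "\<lambda>x. frechet_derivative f (at x) v"]) (use Suc.prems * in auto)
  qed
qed

text \<open>Lets an explicit derivative formula \<open>D\<close> stand in for the chosen
  \<open>frechet_derivative\<close>; the closure proofs below run through it.\<close>

lemma Ck_on_SucI:
  assumes U: "open U" and D: "\<And>x. x \<in> U \<Longrightarrow> (f has_derivative D x) (at x)"
    and C: "\<And>v. Ck_on k U (\<lambda>x. D x v)"
  shows "Ck_on (Suc k) U f"
  unfolding Ck_on.simps
proof (intro conjI ballI allI)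
  show "f differentiable at x" if "x \<in> U" for x
    using D[OF that] by (auto simp: differentiable_def)
  show "Ck_on k U (\<lambda>x. frechet_derivative f (at x) v)" for v
    by (rule Ck_on_cong[OF U C[of v]]) (simp add: frechet_derivative_at[OF D, symmetric])
qed

lemma Ck_on_has_derivative:
  "Ck_on (Suc k) U f \<Longrightarrow> x \<in> U \<Longrightarrow> (f has_derivative frechet_derivative f (at x)) (at x)"
  by (simp add: frechet_derivative_works)

lemma Ck_on_mono_Suc: "Ck_on (Suc k) U f \<Longrightarrow> Ck_on k U f"
proof (induction k arbitrary: f)
  case 0
  then show ?case
    by (auto intro!: continuous_at_imp_continuous_on differentiable_imp_continuous_within)
qed auto

lemma Ck_on_const: "Ck_on k U (\<lambda>x. c)"
proof (induction k arbitrary: c)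
  case (Suc k)
  then show ?case by (auto simp: frechet_derivative_const)
qed auto

lemma Ck_on_id: "Ck_on k U (\<lambda>x. x)"
  by (cases k) (auto simp: Ck_on_const frechet_derivative_ident)

lemma Ck_on_add:
  assumes "open U" "Ck_on k U f" "Ck_on k U g"
  shows "Ck_on k U (\<lambda>x. f x + g x)"
  using assms
proof (induction k arbitrary: f g)
  case (Suc k)
  show ?case
  proof (rule Ck_on_SucI[OF Suc.prems(1)])
    show "((\<lambda>x. f x + g x) has_derivative
        (\<lambda>v. frechet_derivative f (at x) v + frechet_derivative g (at x) v)) (at x)"
      if "x \<in> U" for x
      using that Suc.prems by (intro has_derivative_add Ck_on_has_derivative)
  qed (use Suc in auto)
qed (auto intro: continuous_on_add)

lemma Ck_on_linear:
  assumes h: "bounded_linear h" and "open U" "Ck_on k U f"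
  shows "Ck_on k U (\<lambda>x. h (f x))"
  using assms(2-)
proof (induction k arbitrary: f)
  case 0
  then show ?case by (simp add: bounded_linear.continuous_on[OF h])
next
  case (Suc k)
  show ?case
  proof (rule Ck_on_SucI[OF Suc.prems(1)])
    show "((\<lambda>x. h (f x)) has_derivative (\<lambda>v. h (frechet_derivative f (at x) v))) (at x)"
      if "x \<in> U" for x
      using that Suc.prems by (intro bounded_linear.has_derivative[OF h] Ck_on_has_derivative)
  qed (use Suc in auto)
qed

text \<open>Leibniz rule: each summand of the derivative pairs one factor with a derivative of the
  other, so the induction must range over all \<open>f\<close> and \<open>g\<close>; the
  undifferentiated factor is lowered one class.\<close>

lemma Ck_on_bilinear:
  fixes f :: "'a::euclidean_space \<Rightarrow> 'b::euclidean_space"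
    and g :: "'a \<Rightarrow> 'c::euclidean_space"
    and prod :: "'b \<Rightarrow> 'c \<Rightarrow> 'd::euclidean_space"
  assumes h: "bounded_bilinear prod" and "open U" "Ck_on k U f" "Ck_on k U g"
  shows "Ck_on k U (\<lambda>x. prod (f x) (g x))"
  using assms(2-)
proof (induction k arbitrary: f g)
  case 0
  then show ?case by (simp add: bounded_bilinear.continuous_on[OF h])
next
  case (Suc k)
  show ?case
  proof (rule Ck_on_SucI[OF Suc.prems(1)])
    show "((\<lambda>x. prod (f x) (g x)) has_derivative (\<lambda>v. prod (f x) (frechet_derivative g (at x) v)
        + prod (frechet_derivative f (at x) v) (g x))) (at x)"
      if "x \<in> U" for x
      using that Suc.prems by (intro bounded_bilinear.FDERIV[OF h] Ck_on_has_derivative)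
    show "Ck_on k U (\<lambda>x. prod (f x) (frechet_derivative g (at x) v)
        + prod (frechet_derivative f (at x) v) (g x))" for v
      using Suc.prems by (intro Ck_on_add Suc.IH) (auto intro: Ck_on_mono_Suc)
  qed
qed

text \<open>The derivative of \<open>1/f\<close> contains \<open>1/f\<close> again, but only to
  class \<open>k\<close>, which the induction hypothesis provides.\<close>

lemma Ck_on_inverse:
  fixes f :: "'a::euclidean_space \<Rightarrow> real"
  assumes "open U" "Ck_on k U f" "\<And>x. x \<in> U \<Longrightarrow> f x \<noteq> 0"
  shows "Ck_on k U (\<lambda>x. inverse (f x))"
  using assms
proof (induction k)
  case 0
  then show ?case by (auto intro!: continuous_on_inverse)
next
  case (Suc k)
  have *: "Ck_on k U (\<lambda>x. inverse (f x))"
    by (intro Suc.IH Suc.prems Ck_on_mono_Suc)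
  have mult: "Ck_on k U (\<lambda>x. g x * h x)" if "Ck_on k U g" "Ck_on k U h" for g h :: "'a \<Rightarrow> real"
    by (rule Ck_on_bilinear[OF bounded_bilinear_mult Suc.prems(1) that])
  show ?case
  proof (rule Ck_on_SucI[OF Suc.prems(1)])
    show "((\<lambda>x. inverse (f x)) has_derivative
        (\<lambda>v. - 1 * (inverse (f x) * frechet_derivative f (at x) v * inverse (f x)))) (at x)"
      if "x \<in> U" for x
      using Deriv.has_derivative_inverse[OF Suc.prems(3)[OF that] Ck_on_has_derivative[OF Suc.prems(2) that]]
      by simp
    show "Ck_on k U (\<lambda>x. - 1 * (inverse (f x) * frechet_derivative f (at x) v * inverse (f x)))"
      for v
      using Suc.prems(2) by (intro mult * Ck_on_const) auto
  qed
qed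

lemma smooth_on_const: "smooth_on U (\<lambda>x. c)"
  and smooth_on_id: "smooth_on U (\<lambda>x. x)"
  by (auto simp: smooth_on_def Ck_on_const Ck_on_id)

lemma smooth_on_cong:
  "open U \<Longrightarrow> smooth_on U f \<Longrightarrow> (\<And>x. x \<in> U \<Longrightarrow> f x = g x) \<Longrightarrow> smooth_on U g"
  unfolding smooth_on_def using Ck_on_cong by blast

lemma smooth_on_add:
  "open U \<Longrightarrow> smooth_on U f \<Longrightarrow> smooth_on U g \<Longrightarrow> smooth_on U (\<lambda>x. f x + g x)"
  by (auto simp: smooth_on_def Ck_on_add)

lemma smooth_on_linear:
  "bounded_linear h \<Longrightarrow> open U \<Longrightarrow> smooth_on U f \<Longrightarrow> smooth_on U (\<lambda>x. h (f x))"
  by (auto simp: smooth_on_def Ck_on_linear)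

lemma smooth_on_bilinear:
  "bounded_bilinear h \<Longrightarrow> open U \<Longrightarrow> smooth_on U f \<Longrightarrow> smooth_on U g
    \<Longrightarrow> smooth_on U (\<lambda>x. h (f x) (g x))"
  by (auto simp: smooth_on_def Ck_on_bilinear)

lemma smooth_on_inverse:
  "open U \<Longrightarrow> smooth_on U f \<Longrightarrow> (\<And>x. x \<in> U \<Longrightarrow> f x \<noteq> 0) \<Longrightarrow> smooth_on U (\<lambda>x. inverse (f x :: real))"
  by (auto simp: smooth_on_def Ck_on_inverse)

lemma smooth_on_imp_continuous_on: "smooth_on U f \<Longrightarrow> continuous_on U f"
  unfolding smooth_on_def using Ck_on.simps(1) by blast

lemma smooth_on_imp_differentiable: "smooth_on U f \<Longrightarrow> x \<in> U \<Longrightarrow> f differentiable at x"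
  unfolding smooth_on_def using Ck_on.simps(2) by blast

lemmas smooth_on_mult = smooth_on_bilinear[OF bounded_bilinear_mult]
lemmas smooth_on_scaleR = smooth_on_bilinear[OF bounded_bilinear_scaleR]
lemmas smooth_on_minus = smooth_on_linear[OF bounded_linear_minus[OF bounded_linear_ident]]
lemmas smooth_on_fst = smooth_on_linear[OF bounded_linear_fst]
lemmas smooth_on_snd = smooth_on_linear[OF bounded_linear_snd]
lemmas smooth_on_vec_nth = smooth_on_linear[OF bounded_linear_vec_nth]

lemma smooth_on_diff:
  "open U \<Longrightarrow> smooth_on U f \<Longrightarrow> smooth_on U g \<Longrightarrow> smooth_on U (\<lambda>x. f x - g x)"
  using smooth_on_add[OF _ _ smooth_on_minus] by fastforce

lemma smooth_on_sum:
  "open U \<Longrightarrow> (\<And>i. i \<in> I \<Longrightarrow> smooth_on U (f i)) \<Longrightarrow> smooth_on U (\<lambda>x. \<Sum>i\<in>I. f i x)"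
  by (induction I rule: infinite_finite_induct) (auto intro: smooth_on_const smooth_on_add)

lemma smooth_on_prod:
  fixes f :: "'i \<Rightarrow> 'a::euclidean_space \<Rightarrow> real"
  shows "open U \<Longrightarrow> (\<And>i. i \<in> I \<Longrightarrow> smooth_on U (f i)) \<Longrightarrow> smooth_on U (\<lambda>x. \<Prod>i\<in>I. f i x)"
  by (induction I rule: infinite_finite_induct) (auto intro: smooth_on_const smooth_on_mult)

lemma smooth_on_Pair:
  assumes "open U" "smooth_on U f" "smooth_on U g"
  shows "smooth_on U (\<lambda>x. (f x, g x))"
proof -
  have "smooth_on U (\<lambda>x. (f x, 0) + (0, g x))"
    using assms by (intro smooth_on_add smooth_on_linear[where h = "\<lambda>z. (z, 0)"]
        smooth_on_linear[where h = "\<lambda>z. (0, z)"] bounded_linear_Pair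
        bounded_linear_ident bounded_linear_zero)
  then show ?thesis by simp
qed

lemma smooth_on_vec_lambda:
  fixes f :: "'n::finite \<Rightarrow> 'a::euclidean_space \<Rightarrow> 'b::euclidean_space"
  assumes "open U" "\<And>i. smooth_on U (f i)"
  shows "smooth_on U (\<lambda>x. \<chi> i. f i x)"
proof -
  have "bounded_linear (axis i :: 'b \<Rightarrow> 'b^'n)" for i
    unfolding linear_conv_bounded_linear[symmetric]
    by (rule linearI) (auto simp: vec_eq_iff axis_def)
  then have "smooth_on U (\<lambda>x. \<Sum>i\<in>UNIV. axis i (f i x))"
    using assms by (intro smooth_on_sum smooth_on_linear[where h = "axis _"])
  moreover have "(\<Sum>i\<in>UNIV. axis i (f i x)) = (\<chi> i. f i x)" for x
    by (simp add: vec_eq_iff axis_def)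
  ultimately show ?thesis by simp
qed

section \<open>Smoothness of matrix operations\<close>

lemma bounded_linear_transpose: "bounded_linear (transpose :: real^'m^'n \<Rightarrow> real^'n^'m)"
  unfolding linear_conv_bounded_linear[symmetric]
  by (rule linearI) (auto simp: transpose_def vec_eq_iff)

lemma bounded_bilinear_matrix_mul:
  "bounded_bilinear ((**) :: real^'m^'n \<Rightarrow> real^'p^'m \<Rightarrow> real^'p^'n)"
  unfolding bilinear_conv_bounded_bilinear[symmetric] bilinear_def
  by (auto intro!: linearI
      simp: matrix_matrix_mult_def vec_eq_iff algebra_simps sum.distrib sum_distrib_left)

lemmas smooth_on_matrix_mul = smooth_on_bilinear[OF bounded_bilinear_matrix_mul]
lemmas smooth_on_transpose = smooth_on_linear[OF bounded_linear_transpose]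

lemma smooth_on_det:
  fixes A :: "'a::euclidean_space \<Rightarrow> real^'n^'n"
  assumes "open U" "\<And>i j. smooth_on U (\<lambda>x. A x $ i $ j)"
  shows "smooth_on U (\<lambda>x. det (A x))"
  unfolding det_def using assms
  by (intro smooth_on_sum smooth_on_mult smooth_on_prod smooth_on_const)

lemma matrix_inv_mul:
  fixes A :: "real^'n^'n"
  assumes "det A \<noteq> 0"
  shows "A ** matrix_inv A = mat 1" "matrix_inv A ** A = mat 1"
  using assms someI_ex[of "\<lambda>B. A ** B = mat 1 \<and> B ** A = mat 1"]
  unfolding matrix_inv_def invertible_det_nz[symmetric] invertible_def by auto

text \<open>Cramer's rule applied to each column of the identity. It displays the entries of the
  inverse as rational functions of those of \<open>A\<close>, from which smoothness follows.\<close>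

lemma matrix_inv_cramer:
  fixes A :: "real^'n^'n"
  assumes "det A \<noteq> 0"
  shows "matrix_inv A = (\<chi> k l. det (\<chi> i j. if j = k then mat 1 $ i $ l else A $ i $ j) * inverse (det A))"
proof -
  have "column l (matrix_inv A) =
      (\<chi> k. det (\<chi> i j. if j = k then column l (mat 1) $ i else A $ i $ j) / det A)" for l
    unfolding cramer[OF assms, symmetric]
    using matrix_inv_mul(1)[OF assms]
    by (simp add: vec_eq_iff column_def matrix_vector_mult_def matrix_matrix_mult_def)
  then show ?thesis by (simp add: vec_eq_iff column_def divide_inverse cong: if_cong)
qed

lemma smooth_on_matrix_inv:
  fixes A :: "'a::euclidean_space \<Rightarrow> real^'n^'n"
  assumes U: "open U" and A: "smooth_on U A" and nz: "\<And>x. x \<in> U \<Longrightarrow> det (A x) \<noteq> 0"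
  shows "smooth_on U (\<lambda>x. matrix_inv (A x))"
proof (rule smooth_on_cong[OF U _ matrix_inv_cramer[OF nz, symmetric]])
  \<comment> \<open>The entries of Cramer's numerators are either constants or entries of
    \<open>A\<close>; the instance \<open>b = False\<close> serves the denominator.\<close>
  have "smooth_on U (\<lambda>x. if b then c else A x $ i $ j)" for b c i j
    by (cases b) (auto intro!: smooth_on_const smooth_on_vec_nth U A)
  from this this[of False] show "smooth_on U (\<lambda>x. \<chi> k l. det (\<chi> i j. if j = k then mat 1 $ i $ l else A x $ i $ j)
      * inverse (det (A x)))"
    by (intro smooth_on_vec_lambda smooth_on_mult smooth_on_det smooth_on_inverse U nz) simp_all
qed

lemmas smooth_on_intros = smooth_on_const smooth_on_id smooth_on_add smooth_on_diff
  smooth_on_scaleR smooth_on_fst smooth_on_snd smooth_on_Pair smooth_on_matrix_mul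
  smooth_on_transpose smooth_on_matrix_inv

subsection \<open>Linear algebra\<close>

text \<open>On the orthogonal complement \<open>C\<close> of the kernel, \<open>f\<close> is
  injective and already attains its whole range.\<close>

lemma rank_nullity:
  fixes f :: "'a::euclidean_space \<Rightarrow> 'b::euclidean_space"
  assumes f: "linear f"
  shows "dim {x. f x = 0} + dim (range f) = DIM('a)"
proof -
  let ?K = "{x. f x = 0}"
  define C where "C = {y. \<forall>x\<in>?K. orthogonal x y}"
  have K: "subspace ?K" by (rule linear_subspace_kernel[OF f])
  have C: "subspace C" unfolding C_def by (rule subspace_orthogonal_to_vectors)
  have dimC: "dim C + dim ?K = DIM('a)"
    using dim_subspace_orthogonal_to_vectors[OF K subspace_UNIV] by (simp add: C_def)
  have "inj_on f (span C)"
  proof (subst span_eq_iff[THEN iffD2, OF C], rule inj_onI)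
    fix x y assume *: "x \<in> C" "y \<in> C" "f x = f y"
    then have "x - y \<in> C" "x - y \<in> ?K"
      using C by (auto simp: subspace_diff linear_diff[OF f])
    then show "x = y" unfolding C_def orthogonal_def by fastforce
  qed
  then have "dim (f ` C) = dim C" by (rule dim_image_eq[OF f])
  moreover have "f ` C = range f"
  proof (intro equalityI subsetI)
    fix z assume "z \<in> range f"
    then obtain x where z: "z = f x" by auto
    obtain y w where "y \<in> span ?K" and w: "\<And>v. v \<in> span ?K \<Longrightarrow> orthogonal w v" and x: "x = y + w"
      by (rule orthogonal_subspace_decomp_exists[of ?K x]) auto
    then have "f y = 0" using K by (simp add: span_eq_iff[THEN iffD2])
    moreover have "w \<in> C"
      using w by (auto simp: C_def orthogonal_commute intro: span_base)
    ultimately show "z \<in> f ` C" by (auto simp: z x linear_add[OF f])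
  qed auto
  ultimately show ?thesis using dimC by simp
qed

interpretation matrix_mul: bounded_bilinear "(**) :: real^'m^'n \<Rightarrow> real^'p^'m \<Rightarrow> real^'p^'n"
  by (rule bounded_bilinear_matrix_mul)

lemmas linear_transpose = bounded_linear.linear[OF bounded_linear_transpose]

lemmas matrix_algebra = matrix_mul.add_left matrix_mul.add_right matrix_mul.diff_left
  matrix_mul.diff_right matrix_mul.minus_left matrix_mul.minus_right
  matrix_mul.scaleR_left matrix_mul.scaleR_right matrix_mul.zero_left matrix_mul.zero_right
  linear_add[OF linear_transpose] linear_diff[OF linear_transpose]
  linear_neg[OF linear_transpose] linear_scale[OF linear_transpose] linear_0[OF linear_transpose]
  matrix_transpose_mul matrix_mul_assoc

text \<open>A one-sided inverse suffices for square matrices, because \<open>det\<close> is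
  multiplicative.\<close>

lemma matrix_inv_unique:
  fixes A B :: "real^'n^'n"
  assumes "A ** B = mat 1"
  shows "det A \<noteq> 0" "matrix_inv A = B"
proof -
  have "det A * det B = 1" using assms by (simp add: det_I flip: det_mul)
  then show *: "det A \<noteq> 0" by auto
  have "matrix_inv A = matrix_inv A ** (A ** B)" by (simp add: assms)
  also have "\<dots> = B" by (simp add: matrix_mul_assoc matrix_inv_mul(2)[OF *])
  finally show "matrix_inv A = B" .
qed

lemma open_det_nonzero:
  fixes F :: "'a::euclidean_space \<Rightarrow> real^'n^'n"
  assumes "open W" "smooth_on W F"
  shows "open {x \<in> W. det (F x) \<noteq> 0}"
proof -
  have "continuous_on W (\<lambda>x. det (F x))"
    using assms by (intro smooth_on_imp_continuous_on smooth_on_det smooth_on_vec_nth)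
  then have "open (W \<inter> (\<lambda>x. det (F x)) -` (- {0}))"
    using assms by (intro continuous_open_preimage) auto
  then show ?thesis by (simp add: vimage_def Int_def)
qed

subsection \<open>Nondegeneracy\<close>

lemma frob_inner_eq_inner: "frob_inner A B = A \<bullet> B"
proof -
  have "frob_inner A B = (\<Sum>j\<in>UNIV. \<Sum>i\<in>UNIV. A $ i $ j * B $ i $ j)"
    by (simp add: frob_inner_def trace_def matrix_matrix_mult_def transpose_def)
  also have "\<dots> = A \<bullet> B"
    by (subst sum.swap) (simp add: inner_vec_def)
  finally show ?thesis .
qed

lemma omega_eq: "omega u v = fst u \<bullet> snd v - snd u \<bullet> fst v"
  by (simp add: omega_def frob_inner_eq_inner)

lemma symplectic_form_omega:
  "symplectic_form (omega :: (real^'m^'n) \<times> (real^'m^'n) \<Rightarrow> _)"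
  unfolding symplectic_form_def
proof (intro conjI allI)
  show "bilinear omega"
    unfolding bilinear_def
    by (auto intro!: linearI simp: omega_eq inner_simps algebra_simps)
  show "omega u u = 0" for u :: "(real^'m^'n) \<times> (real^'m^'n)"
    by (simp add: omega_eq inner_commute)
  show "nondegenerate_on (UNIV :: ((real^'m^'n) \<times> (real^'m^'n)) set) omega"
    unfolding nondegenerate_on_def
  proof (intro ballI impI)
    fix u :: "(real^'m^'n) \<times> (real^'m^'n)"
    assume "\<forall>v\<in>UNIV. omega u v = 0"
    \<comment> \<open>Testing against the standard complex structure applied to \<open>u\<close>
      gives the squared norm of \<open>u\<close>.\<close>
    then have "omega u (- snd u, fst u) = 0" by blast
    then show "u = 0"
      by (simp add: omega_eq prod_eq_iff add_nonneg_eq_0_iff)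
  qed
qed

text \<open>The adjoint of \<open>S \<mapsto> S ** Q\<close>; it turns pairings with Hamiltonian
  directions into pairings of \<open>S\<close> with linearized constraints.\<close>

lemma inner_matrix_mul_left:
  fixes S :: "real^'n^'n" and Q A :: "real^'m^'n"
  shows "A \<bullet> (S ** Q) = S \<bullet> (A ** transpose Q)"
proof -
  have "A \<bullet> (S ** Q) = (\<Sum>i\<in>UNIV. \<Sum>j\<in>UNIV. \<Sum>l\<in>UNIV. A $ i $ j * (S $ i $ l * Q $ l $ j))"
    by (simp add: inner_vec_def matrix_matrix_mult_def sum_distrib_left)
  also have "\<dots> = (\<Sum>i\<in>UNIV. \<Sum>l\<in>UNIV. \<Sum>j\<in>UNIV. A $ i $ j * (S $ i $ l * Q $ l $ j))"
    by (intro sum.cong refl sum.swap)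
  also have "\<dots> = S \<bullet> (A ** transpose Q)"
    by (simp add: inner_vec_def matrix_matrix_mult_def transpose_def sum_distrib_left mult_ac)
  finally show ?thesis .
qed

lemma inner_transpose: "transpose A \<bullet> transpose B = A \<bullet> (B :: real^'m^'n)"
  unfolding inner_vec_def transpose_def by (subst sum.swap) simp

text \<open>A symmetric matrix is orthogonal to skew ones, so it sees only the symmetric part of
  \<open>X\<close>, and that part is what the linearized constraints control.\<close>

lemma inner_symmetric_matrix:
  fixes S X :: "real^'n^'n"
  assumes "transpose S = S"
  shows "S \<bullet> X = (S \<bullet> (X + transpose X)) / 2"
  using inner_transpose[of S X] assms by (simp add: inner_add_right)

text \<open>The kernel at \<open>p\<close> of the derivative of the two constraints. At points of
  \<open>W_space k\<close> it is identified with the tangent space at the end, so nondegeneracy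
  becomes pure linear algebra.\<close>

definition W_kernel :: "(real^'m^'n) \<times> (real^'m^'n) \<Rightarrow> ((real^'m^'n) \<times> (real^'m^'n)) set" where
  "W_kernel p = {u. fst u ** transpose (fst p) + fst p ** transpose (fst u) = 0 \<and>
     fst u ** transpose (snd p) + snd p ** transpose (fst u)
       + snd u ** transpose (fst p) + fst p ** transpose (snd u) = 0}"

lemma nondegenerate_W_kernel:
  fixes Q P :: "real^'m^'n"
  assumes Q: "Q ** transpose Q = mat 1"
  shows "nondegenerate_on (W_kernel (Q, P)) omega"
  unfolding nondegenerate_on_def
proof (intro ballI impI)
  fix u assume u: "u \<in> W_kernel (Q, P)" and 0: "\<forall>v\<in>W_kernel (Q, P). omega u v = 0"
  obtain A B where AB: "u = (A, B)" by fastforce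
  have u1: "A ** transpose Q + Q ** transpose A = 0"
    and u2: "A ** transpose P + P ** transpose A + B ** transpose Q + Q ** transpose B = 0"
    using u by (auto simp: W_kernel_def AB)
  \<comment> \<open>Up to sign this value is the sum of \<open>S\<close> and \<open>R\<close> paired
    with the two linearized constraints at \<open>u\<close>, which vanish.\<close>
  have ham: "omega u (R ** Q, - (S ** Q + R ** P)) = 0"
    if R: "transpose R = R" and S: "transpose S = S" for R S :: "real^'n^'n"
  proof -
    have "S \<bullet> (A ** transpose Q) = 0"
      using inner_symmetric_matrix[OF S, of "A ** transpose Q"] u1 by (simp add: matrix_algebra)
    moreover have "A ** transpose P + B ** transpose Q
        + transpose (A ** transpose P + B ** transpose Q) = 0"
      using u2 by (simp add: matrix_algebra algebra_simps)
    then have "R \<bullet> (A ** transpose P + B ** transpose Q) = 0"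
      using inner_symmetric_matrix[OF R, of "A ** transpose P + B ** transpose Q"]
      by simp
    ultimately show ?thesis
      by (simp add: omega_eq AB inner_add_right inner_diff_right inner_matrix_mul_left)
  qed
  have "omega u (X, Y) = 0" for X Y
  proof -
    \<comment> \<open>Any \<open>(X, Y)\<close> is split into a kernel vector and a Hamiltonian one.
      Subtracting \<open>R ** Q\<close> removes \<open>2 R\<close> from the first linearized
      constraint, so \<open>R\<close> is half the defect of \<open>X\<close>; then \<open>S\<close>
      is minus half of what remains in the second one.\<close>
    define R where "R = (1/2) *\<^sub>R (X ** transpose Q + Q ** transpose X)"
    define X' where "X' = X - R ** Q"
    define S where "S = - (1/2) *\<^sub>R (X' ** transpose P + P ** transpose X'
       + (Y + R ** P) ** transpose Q + Q ** transpose (Y + R ** P))"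
    have R: "transpose R = R" by (simp add: R_def matrix_algebra algebra_simps)
    have S: "transpose S = S" by (simp add: S_def matrix_algebra algebra_simps)
    have QQ: "Z ** Q ** transpose Q = Z" for Z :: "real^'n^'n"
      by (simp add: Q flip: matrix_mul_assoc)
    have X': "X' ** transpose Q + Q ** transpose X' = 0"
    proof -
      have "R + R = X ** transpose Q + Q ** transpose X"
        by (simp add: R_def flip: scaleR_add_left)
      then show ?thesis
        using R unfolding X'_def by (simp add: matrix_algebra QQ Q algebra_simps)
    qed
    define Y' where "Y' = Y + (S ** Q + R ** P)"
    have "X' ** transpose P + P ** transpose X' + Y' ** transpose Q + Q ** transpose Y' = - 2 *\<^sub>R S + S + S"
      unfolding Y'_def using S QQ Q by (simp add: S_def matrix_algebra algebra_simps)
    also have "\<dots> = 0" by (simp add: scaleR_2)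
    finally have "(X', Y') \<in> W_kernel (Q, P)"
      using X' by (simp add: W_kernel_def)
    then have "omega u (X', Y') = 0" using 0 by blast
    moreover have "omega u (X, Y) = omega u (X', Y') + omega u (R ** Q, - (S ** Q + R ** P))"
      by (simp add: omega_eq X'_def Y'_def inner_diff_right inner_add_right)
    ultimately show ?thesis using ham[OF R S] by simp
  qed
  then have "\<forall>v. omega u v = 0" by auto
  then show "u = 0"
    using symplectic_form_omega unfolding symplectic_form_def nondegenerate_on_def by blast
qed

subsection \<open>Slice charts\<close>

text \<open>Charts are centred at \<open>Q0\<close> alone: their domains contain
  \<open>(Q0, P)\<close> for every \<open>P\<close>.\<close>

locale stiefel_point =
  fixes Q0 :: "real^'m^'n"
  assumes Q0: "Q0 ** transpose Q0 = mat 1"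
begin

lemma Q0_cancel: "Z ** Q0 ** transpose Q0 = Z" for Z :: "real^'n^'p"
  by (simp add: Q0 flip: matrix_mul_assoc)

text \<open>The component \<open>b\<close> of the introduction: the rows are projected orthogonally
  onto the complement of the row space of \<open>Q0\<close>.\<close>

definition normal_part :: "real^'m^'n \<Rightarrow> real^'m^'n" where
  "normal_part X = X - X ** transpose Q0 ** Q0"

lemma normal_part_Q0: "normal_part X ** transpose Q0 = 0"
  by (simp add: normal_part_def matrix_algebra Q0_cancel)

text \<open>In the notation of the introduction, \<open>cay Q\<close> is \<open>c\<close> and \<open>cay_normal Q\<close> is \<open>y\<close>, as
  \<open>c (Q + Q\<^sub>0) = c (1 + a) Q\<^sub>0 + c b = Q\<^sub>0 + y\<close>. The chart packs the square matrix that becomes skew and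
  \<open>y\<close> into a single matrix of the shape of \<open>Q\<close>.\<close>

definition cay :: "real^'m^'n \<Rightarrow> real^'n^'n" where
  "cay Q = matrix_inv (mat 1 + Q ** transpose Q0)"

definition cay_normal :: "real^'m^'n \<Rightarrow> real^'m^'n" where
  "cay_normal Q = cay Q ** (Q + Q0) - Q0"

definition chart :: "real^'m^'n \<Rightarrow> real^'m^'n" where
  "chart Q = (cay Q - (1/2) *\<^sub>R (mat 1 + cay_normal Q ** transpose (cay_normal Q))) ** Q0
     + cay_normal Q"

text \<open>Recovers \<open>c\<close> from a chart value \<open>X\<close>: the normal part of
  \<open>X\<close> is \<open>y\<close>, and \<open>X Q0^T\<close> is
  \<open>c - (1 + y y^T) / 2\<close>.\<close>

definition cay_of_chart :: "real^'m^'n \<Rightarrow> real^'n^'n" where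
  "cay_of_chart X = X ** transpose Q0
     + (1/2) *\<^sub>R (mat 1 + normal_part X ** transpose (normal_part X))"

text \<open>Solves \<open>c (Q + Q0) = y + Q0\<close> for \<open>Q\<close>.\<close>

definition chart_inv :: "real^'m^'n \<Rightarrow> real^'m^'n" where
  "chart_inv X = matrix_inv (cay_of_chart X) ** (normal_part X + Q0) - Q0"

definition chart_dom :: "(real^'m^'n) set" where
  "chart_dom = {Q. det (mat 1 + Q ** transpose Q0) \<noteq> 0}"

definition chart_ran :: "(real^'m^'n) set" where
  "chart_ran = {X. det (cay_of_chart X) \<noteq> 0}"

section \<open>The chart and its inverse undo each other\<close>

lemma cay_mul:
  assumes "Q \<in> chart_dom"
  shows "cay Q ** (mat 1 + Q ** transpose Q0) = mat 1"
    "(mat 1 + Q ** transpose Q0) ** cay Q = mat 1"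
  using matrix_inv_mul assms by (auto simp: cay_def chart_dom_def)

lemma cay_normal_Q0:
  assumes "Q \<in> chart_dom"
  shows "cay_normal Q ** transpose Q0 = 0"
  using cay_mul(1)[OF assms]
  by (simp add: cay_normal_def matrix_algebra Q0 Q0_cancel add.commute)

lemma chart_Q0:
  assumes "Q \<in> chart_dom"
  shows "chart Q ** transpose Q0
    = cay Q - (1/2) *\<^sub>R (mat 1 + cay_normal Q ** transpose (cay_normal Q))"
  by (simp add: chart_def matrix_mul.add_left Q0_cancel cay_normal_Q0[OF assms])

lemma normal_part_chart: "Q \<in> chart_dom \<Longrightarrow> normal_part (chart Q) = cay_normal Q"
  by (simp add: normal_part_def chart_Q0) (simp add: chart_def)

lemma cay_of_chart_chart: "Q \<in> chart_dom \<Longrightarrow> cay_of_chart (chart Q) = cay Q"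
  by (simp add: cay_of_chart_def normal_part_chart chart_Q0)

lemma chart_in_ran:
  assumes "Q \<in> chart_dom" shows "chart Q \<in> chart_ran"
  using matrix_inv_unique(1)[OF cay_mul(1)[OF assms]] assms
  by (simp add: chart_ran_def cay_of_chart_chart)

lemma chart_inv_chart:
  assumes "Q \<in> chart_dom" shows "chart_inv (chart Q) = Q"
proof -
  have "matrix_inv (cay Q) = mat 1 + Q ** transpose Q0"
    by (rule matrix_inv_unique(2)[OF cay_mul(1)[OF assms]])
  then show ?thesis
    using assms cay_mul(2)[OF assms]
    by (simp add: chart_inv_def cay_of_chart_chart normal_part_chart cay_normal_def matrix_mul_assoc)
qed

lemma cay_chart_inv:
  assumes "X \<in> chart_ran"
  shows "chart_inv X \<in> chart_dom" "cay (chart_inv X) = cay_of_chart X"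
proof -
  have nz: "det (cay_of_chart X) \<noteq> 0" using assms by (simp add: chart_ran_def)
  \<comment> \<open>Multiplying \<open>c^-1 (y + Q0) - Q0\<close> by \<open>Q0^T\<close> leaves
    \<open>c^-1 - 1\<close>, since \<open>y Q0^T = 0\<close>.\<close>
  have *: "mat 1 + chart_inv X ** transpose Q0 = matrix_inv (cay_of_chart X)"
    by (simp add: chart_inv_def matrix_mul.diff_left matrix_mul.add_left Q0 normal_part_Q0
        flip: matrix_mul_assoc)
  show "chart_inv X \<in> chart_dom"
    using matrix_inv_unique(1)[OF matrix_inv_mul(2)[OF nz]] by (simp add: chart_dom_def *)
  show "cay (chart_inv X) = cay_of_chart X"
    using matrix_inv_unique(2)[OF matrix_inv_mul(2)[OF nz]] by (simp add: cay_def *)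
qed

lemma chart_chart_inv:
  assumes "X \<in> chart_ran" shows "chart (chart_inv X) = X"
proof -
  have nz: "det (cay_of_chart X) \<noteq> 0" using assms by (simp add: chart_ran_def)
  have *: "cay_normal (chart_inv X) = normal_part X"
    by (simp add: cay_normal_def cay_chart_inv[OF assms])
      (simp add: chart_inv_def matrix_mul_assoc matrix_inv_mul[OF nz])
  show ?thesis
    by (simp add: chart_def * cay_chart_inv[OF assms])
      (simp add: cay_of_chart_def normal_part_def)
qed

text \<open>Compute \<open>(y + Q0) (y + Q0)^T\<close> twice. It is \<open>1 + y y^T\<close> because
  \<open>y Q0^T = 0\<close>. It is also \<open>c (Q + Q0) (Q + Q0)^T c^T\<close>, whose middle
  factor is \<open>(Q Q^T - 1) + ?A + ?A^T\<close>; the last two terms contribute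
  \<open>c^T + c\<close> because \<open>c\<close> inverts \<open>?A\<close>.\<close>

lemma chart_identity:
  assumes "Q \<in> chart_dom"
  shows "chart Q ** transpose Q0 + Q0 ** transpose (chart Q)
    = - (cay Q ** (Q ** transpose Q - mat 1) ** transpose (cay Q))"
proof -
  let ?c = "cay Q" and ?y = "cay_normal Q" and ?A = "mat 1 + Q ** transpose Q0"
  have A: "?c ** ?A = mat 1" "transpose ?A ** transpose ?c = mat 1"
    using cay_mul[OF assms] by (auto simp flip: matrix_transpose_mul)
  have y: "?y ** transpose Q0 = 0" by (rule cay_normal_Q0[OF assms])
  have "Q0 ** transpose ?y = transpose (?y ** transpose Q0)"
    by (simp add: matrix_transpose_mul)
  then have y': "Q0 ** transpose ?y = 0"
    by (simp add: y linear_0[OF linear_transpose])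
  have "?y ** transpose ?y + mat 1 = (?y + Q0) ** transpose (?y + Q0)"
    by (simp add: matrix_algebra Q0 y y')
  also have "\<dots> = ?c ** ((Q + Q0) ** transpose (Q + Q0)) ** transpose ?c"
    by (simp add: cay_normal_def matrix_transpose_mul matrix_mul_assoc)
  also have "(Q + Q0) ** transpose (Q + Q0) = (Q ** transpose Q - mat 1) + ?A + transpose ?A"
    by (simp add: matrix_algebra Q0)
  also have "?c ** \<dots> ** transpose ?c = ?c ** (Q ** transpose Q - mat 1) ** transpose ?c
      + (?c ** ?A) ** transpose ?c + ?c ** (transpose ?A ** transpose ?c)"
    by (simp only: matrix_mul.add_left matrix_mul.add_right matrix_mul_assoc)
  also have "\<dots> = ?c ** (Q ** transpose Q - mat 1) ** transpose ?c + transpose ?c + ?c"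
    by (simp only: A) simp
  finally have *: "?y ** transpose ?y + mat 1
      = ?c ** (Q ** transpose Q - mat 1) ** transpose ?c + transpose ?c + ?c" .
  have "Q0 ** transpose (chart Q) = transpose (chart Q ** transpose Q0)"
    by (simp add: matrix_transpose_mul)
  also have "\<dots> = transpose ?c - (1/2) *\<^sub>R (mat 1 + ?y ** transpose ?y)"
    unfolding chart_Q0[OF assms] by (simp add: matrix_algebra)
  finally have "chart Q ** transpose Q0 + Q0 ** transpose (chart Q)
      = ?c + transpose ?c - ((1/2) *\<^sub>R (mat 1 + ?y ** transpose ?y) + (1/2) *\<^sub>R (mat 1 + ?y ** transpose ?y))"
    unfolding chart_Q0[OF assms] by (simp only: add_diff_add)
  also have "\<dots> = ?c + transpose ?c - (?y ** transpose ?y + mat 1)"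
    by (simp add: add.commute flip: scaleR_add_left)
  finally have "chart Q ** transpose Q0 + Q0 ** transpose (chart Q)
      = ?c + transpose ?c - (?y ** transpose ?y + mat 1)" .
  then show ?thesis unfolding * by simp
qed

lemma chart_skew_iff:
  assumes "Q \<in> chart_dom"
  shows "chart Q ** transpose Q0 + Q0 ** transpose (chart Q) = 0 \<longleftrightarrow> Q ** transpose Q = mat 1"
proof
  let ?A = "mat 1 + Q ** transpose Q0" and ?E = "Q ** transpose Q - mat 1"
  assume "chart Q ** transpose Q0 + Q0 ** transpose (chart Q) = 0"
  then have "cay Q ** ?E ** transpose (cay Q) = 0"
    by (simp add: chart_identity[OF assms])
  \<comment> \<open>Conjugating with the inverse of \<open>cay Q\<close> isolates
    \<open>?E\<close>.\<close>
  then have "?A ** (cay Q ** ?E ** transpose (cay Q)) ** transpose ?A = 0"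
    by (simp add: matrix_mul.zero_left matrix_mul.zero_right)
  moreover have "?A ** (cay Q ** ?E ** transpose (cay Q)) ** transpose ?A
      = (?A ** cay Q) ** ?E ** transpose (?A ** cay Q)"
    by (simp only: matrix_transpose_mul matrix_mul_assoc)
  ultimately show "Q ** transpose Q = mat 1" by (simp add: cay_mul[OF assms])
next
  assume "Q ** transpose Q = mat 1"
  then show "chart Q ** transpose Q0 + Q0 ** transpose (chart Q) = 0"
    by (simp add: chart_identity[OF assms] matrix_mul.zero_left matrix_mul.zero_right)
qed

lemma smooth_on_chart:
  fixes h :: "'c::euclidean_space \<Rightarrow> real^'m^'n"
  assumes "open W" "smooth_on W h" "\<And>x. x \<in> W \<Longrightarrow> h x \<in> chart_dom"
  shows "smooth_on W (\<lambda>x. chart (h x))"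
  unfolding chart_def cay_normal_def cay_def
  by (intro smooth_on_intros assms) (use assms in \<open>auto simp: chart_dom_def\<close>)

lemma smooth_on_cay_of_chart:
  fixes h :: "'c::euclidean_space \<Rightarrow> real^'m^'n"
  assumes "open W" "smooth_on W h"
  shows "smooth_on W (\<lambda>x. cay_of_chart (h x))"
  unfolding cay_of_chart_def normal_part_def by (intro smooth_on_intros assms)

lemma smooth_on_chart_inv:
  fixes h :: "'c::euclidean_space \<Rightarrow> real^'m^'n"
  assumes "open W" "smooth_on W h" "\<And>x. x \<in> W \<Longrightarrow> h x \<in> chart_ran"
  shows "smooth_on W (\<lambda>x. chart_inv (h x))"
  unfolding chart_inv_def
  by (intro smooth_on_intros smooth_on_cay_of_chart assms)
    (use assms in \<open>auto simp: chart_ran_def normal_part_def intro!: smooth_on_intros\<close>)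

text \<open>The matrix \<open>M\<close> of the introduction, chosen affine in \<open>Q\<close> and
  equal to the identity at \<open>Q0\<close>, hence invertible nearby. It turns \<open>P Q^T\<close>
  into \<open>(P M^T) Q0^T\<close>.\<close>

definition frame_ext :: "real^'m^'n \<Rightarrow> real^'m^'m" where
  "frame_ext Q = mat 1 + transpose Q0 ** (Q - Q0)"

lemma Q0_frame_ext: "Q0 ** frame_ext Q = Q"
  by (simp add: frame_ext_def matrix_mul.add_right matrix_mul.diff_right matrix_mul_assoc Q0)

lemma smooth_on_frame_ext:
  fixes h :: "'c::euclidean_space \<Rightarrow> real^'m^'n"
  assumes "open W" "smooth_on W h"
  shows "smooth_on W (\<lambda>x. frame_ext (h x))"
  unfolding frame_ext_def by (intro smooth_on_intros assms)

text \<open>For symmetric \<open>k\<close>, the shift by \<open>k Q0 / 2\<close>, a particular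
  solution of the second constraint at \<open>Q0\<close>, makes the affine condition on
  \<open>P M^T\<close> homogeneous.\<close>

definition W_chart :: "real^'n^'n \<Rightarrow> (real^'m^'n) \<times> (real^'m^'n) \<Rightarrow> (real^'m^'n) \<times> (real^'m^'n)" where
  "W_chart k z = (chart (fst z), snd z ** transpose (frame_ext (fst z)) - (1/2) *\<^sub>R (k ** Q0))"

definition W_chart_inv :: "real^'n^'n \<Rightarrow> (real^'m^'n) \<times> (real^'m^'n) \<Rightarrow> (real^'m^'n) \<times> (real^'m^'n)" where
  "W_chart_inv k z = (chart_inv (fst z),
     (snd z + (1/2) *\<^sub>R (k ** Q0)) ** matrix_inv (transpose (frame_ext (chart_inv (fst z)))))"

definition W_chart_dom :: "((real^'m^'n) \<times> (real^'m^'n)) set" where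
  "W_chart_dom = {z. fst z \<in> chart_dom \<and> det (frame_ext (fst z)) \<noteq> 0}"

definition W_chart_ran :: "((real^'m^'n) \<times> (real^'m^'n)) set" where
  "W_chart_ran = {z. fst z \<in> chart_ran \<and> det (frame_ext (chart_inv (fst z))) \<noteq> 0}"

section \<open>The chart on pairs is a diffeomorphism of open sets\<close>

lemma open_W_chart_dom: "open W_chart_dom"
proof -
  have 1: "open {z :: (real^'m^'n) \<times> (real^'m^'n). fst z \<in> chart_dom}"
    using open_det_nonzero[OF open_UNIV, of "\<lambda>z. mat 1 + fst z ** transpose Q0"]
    by (simp add: chart_dom_def smooth_on_intros)
  show ?thesis
    using open_det_nonzero[OF 1 smooth_on_frame_ext[OF 1 smooth_on_fst[OF 1 smooth_on_id]]]
    by (simp add: W_chart_dom_def)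
qed

lemma open_W_chart_ran: "open W_chart_ran"
proof -
  \<comment> \<open>Openness comes in two stages: \<open>chart_inv\<close>, which enters the second
    determinant, is known to be smooth only on \<open>chart_ran\<close>.\<close>
  have 1: "open {z :: (real^'m^'n) \<times> (real^'m^'n). fst z \<in> chart_ran}"
    using open_det_nonzero[OF open_UNIV smooth_on_cay_of_chart[OF open_UNIV
          smooth_on_fst[OF open_UNIV smooth_on_id]]]
    by (simp add: chart_ran_def)
  show ?thesis
    using open_det_nonzero[OF 1 smooth_on_frame_ext[OF 1 smooth_on_chart_inv[OF 1
            smooth_on_fst[OF 1 smooth_on_id]]]]
    by (simp add: W_chart_ran_def)
qed

lemma W_chart_maps: "z \<in> W_chart_dom \<Longrightarrow> W_chart k z \<in> W_chart_ran"
  by (simp add: W_chart_dom_def W_chart_ran_def W_chart_def chart_in_ran chart_inv_chart)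

lemma W_chart_inv_maps: "z \<in> W_chart_ran \<Longrightarrow> W_chart_inv k z \<in> W_chart_dom"
  by (simp add: W_chart_dom_def W_chart_ran_def W_chart_inv_def cay_chart_inv)

lemma W_chart_inv_W_chart: "z \<in> W_chart_dom \<Longrightarrow> W_chart_inv k (W_chart k z) = z"
  by (simp add: W_chart_dom_def W_chart_def W_chart_inv_def chart_inv_chart prod_eq_iff
      matrix_inv_mul flip: matrix_mul_assoc)

lemma W_chart_W_chart_inv: "z \<in> W_chart_ran \<Longrightarrow> W_chart k (W_chart_inv k z) = z"
  by (simp add: W_chart_ran_def W_chart_def W_chart_inv_def chart_chart_inv prod_eq_iff
      matrix_inv_mul flip: matrix_mul_assoc)

lemma diffeomorphism_W_chart:
  "diffeomorphism W_chart_dom W_chart_ran (W_chart k) (W_chart_inv k)"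
proof -
  have s1: "smooth_on W_chart_dom (W_chart k)"
    unfolding W_chart_def[abs_def]
    by (intro smooth_on_intros smooth_on_chart smooth_on_frame_ext open_W_chart_dom)
      (simp add: W_chart_dom_def)
  have s2: "smooth_on W_chart_ran (W_chart_inv k)"
    unfolding W_chart_inv_def[abs_def]
    by (intro smooth_on_intros smooth_on_chart_inv smooth_on_frame_ext open_W_chart_ran)
      (simp_all add: W_chart_ran_def)
  have "homeomorphism W_chart_dom W_chart_ran (W_chart k) (W_chart_inv k)"
    using s1 s2
    by (intro homeomorphismI smooth_on_imp_continuous_on)
      (auto simp: W_chart_maps W_chart_inv_maps W_chart_inv_W_chart W_chart_W_chart_inv)
  then show ?thesis
    by (simp add: diffeomorphism_def open_W_chart_dom open_W_chart_ran s1 s2)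
qed

text \<open>Both constraints in chart coordinates; the kernel of this linear map is the
  slice.\<close>

definition sym_part_map ::
  "(real^'m^'n) \<times> (real^'m^'n) \<Rightarrow> (real^'n^'n) \<times> (real^'n^'n)" where
  "sym_part_map z = (fst z ** transpose Q0 + Q0 ** transpose (fst z),
     snd z ** transpose Q0 + Q0 ** transpose (snd z))"

lemma linear_sym_part_map: "linear sym_part_map"
  by (rule linearI) (auto simp: sym_part_map_def matrix_algebra scaleR_right_distrib)

text \<open>Half of \<open>z Q0\<close> is a preimage of a symmetric pair \<open>z\<close>. The
  range is the same for every \<open>Q0\<close>, so all slices have equal dimension.\<close>

lemma range_sym_part_map:
  "range sym_part_map = {z. transpose (fst z) = fst z \<and> transpose (snd z) = snd z}"
proof (intro equalityI subsetI)
  fix z :: "(real^'n^'n) \<times> (real^'n^'n)"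
  assume "z \<in> {z. transpose (fst z) = fst z \<and> transpose (snd z) = snd z}"
  then have "sym_part_map ((1/2) *\<^sub>R (fst z ** Q0), (1/2) *\<^sub>R (snd z ** Q0)) = z"
    by (simp add: sym_part_map_def prod_eq_iff matrix_algebra Q0 Q0_cancel flip: scaleR_add_left)
  then show "z \<in> range sym_part_map" by (metis rangeI)
qed (auto simp: sym_part_map_def matrix_algebra add.commute)

lemma W_chart_skew_iff:
  assumes z: "z \<in> W_chart_dom" and k: "transpose k = k"
  shows "sym_part_map (W_chart k z) = 0 \<longleftrightarrow> z \<in> W_space k"
proof -
  obtain Q P where QP: "z = (Q, P)" by fastforce
  have "transpose (frame_ext Q) ** transpose Q0 = transpose Q"
    by (simp add: Q0_frame_ext flip: matrix_transpose_mul)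
  then have "P ** transpose (frame_ext Q) ** transpose Q0 = P ** transpose Q"
    by (simp flip: matrix_mul_assoc)
  then have "snd (sym_part_map (W_chart k z)) = Q ** transpose P + P ** transpose Q - k"
    using k by (simp add: sym_part_map_def W_chart_def QP matrix_algebra Q0_frame_ext Q0 Q0_cancel
        flip: scaleR_add_left)
  moreover have "fst (sym_part_map (W_chart k z)) = 0 \<longleftrightarrow> Q ** transpose Q = mat 1"
    using z chart_skew_iff[of Q] by (simp add: sym_part_map_def W_chart_def QP W_chart_dom_def)
  ultimately show ?thesis by (auto simp: prod_eq_iff W_space_def QP)
qed

lemma W_chart_slice:
  assumes "transpose k = k"
  shows "W_chart k ` (W_chart_dom \<inter> W_space k) = W_chart_ran \<inter> {z. sym_part_map z = 0}"
proof (intro equalityI subsetI)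
  fix z assume z: "z \<in> W_chart_ran \<inter> {z. sym_part_map z = 0}"
  then have "W_chart_inv k z \<in> W_chart_dom \<inter> W_space k" "z = W_chart k (W_chart_inv k z)"
    using W_chart_skew_iff[OF W_chart_inv_maps assms, of z k]
    by (auto simp: W_chart_inv_maps W_chart_W_chart_inv)
  then show "z \<in> W_chart k ` (W_chart_dom \<inter> W_space k)" by blast
qed (auto simp: W_chart_maps W_chart_skew_iff[OF _ assms])

lemma Q0_in_W_chart_dom: "(Q0, P) \<in> W_chart_dom"
proof -
  \<comment> \<open>At \<open>Q0\<close> the matrix to invert is twice the identity, and the frame
    is the identity.\<close>
  have "(mat 1 + mat 1) ** ((1/2) *\<^sub>R mat 1 :: real^'n^'n) = mat 1"
    unfolding matrix_mul.add_left matrix_mul_lid by (simp flip: scaleR_add_left)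
  from matrix_inv_unique(1)[OF this] show ?thesis
    by (simp add: W_chart_dom_def chart_dom_def frame_ext_def Q0 matrix_mul.zero_right)
qed

end

section \<open>Submanifold structure and nonemptiness\<close>

lemma smooth_submanifold_W_space:
  fixes k :: "real^'n^'n"
  assumes k: "transpose k = k" and ne: "(W_space k :: ((real^'m^'n) \<times> (real^'m^'n)) set) \<noteq> {}"
  shows "\<exists>d. smooth_submanifold d (W_space k :: ((real^'m^'n) \<times> (real^'m^'n)) set)"
proof -
  let ?S = "W_space k :: ((real^'m^'n) \<times> (real^'m^'n)) set"
  \<comment> \<open>The dimension is named before any point is chosen; by rank-nullity the
    subtraction is not truncated.\<close>
  let ?d = "DIM((real^'m^'n) \<times> (real^'m^'n))
    - dim {z :: (real^'n^'n) \<times> (real^'n^'n). transpose (fst z) = fst z \<and> transpose (snd z) = snd z}"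
  have "\<exists>U V (f :: (real^'m^'n) \<times> (real^'m^'n) \<Rightarrow> (real^'m^'n) \<times> (real^'m^'n)) g L.
      p \<in> U \<and> diffeomorphism U V f g \<and> subspace L \<and> dim L = ?d \<and>
      f ` (U \<inter> ?S) = V \<inter> L" if "p \<in> ?S" for p
  proof -
    obtain Q P where p: "p = (Q, P)" by fastforce
    interpret stiefel_point Q
      using that by unfold_locales (simp add: p W_space_def)
    have "(Q, P) \<in> W_chart_dom \<and> diffeomorphism W_chart_dom W_chart_ran (W_chart k) (W_chart_inv k)
        \<and> subspace {z. sym_part_map z = 0} \<and> dim {z. sym_part_map z = 0} = ?d
        \<and> W_chart k ` (W_chart_dom \<inter> ?S) = W_chart_ran \<inter> {z. sym_part_map z = 0}"
      using rank_nullity[OF linear_sym_part_map] unfolding range_sym_part_map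
      by (intro conjI Q0_in_W_chart_dom diffeomorphism_W_chart W_chart_slice[OF k]
          linear_subspace_kernel[OF linear_sym_part_map]) linarith
    then show ?thesis unfolding p by blast
  qed
  then show ?thesis using ne unfolding smooth_submanifold_def by blast
qed

lemma W_space_nonempty:
  fixes k :: "real^'n::finite^'n"
  assumes "CARD('n) \<le> CARD('m::finite)" and k: "transpose k = k"
  shows "(W_space k :: ((real^'m^'n) \<times> (real^'m^'n)) set) \<noteq> {}"
proof -
  \<comment> \<open>Here \<open>n \<le> N\<close> enters: the rows of \<open>Q\<close> are distinct
    standard basis vectors.\<close>
  obtain \<iota> :: "'n \<Rightarrow> 'm" where \<iota>: "inj \<iota>"
    using inj_on_iff_card_le[of "UNIV :: 'n set" "UNIV :: 'm set"] assms by auto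
  define Q :: "real^'m^'n" where "Q = (\<chi> i. axis (\<iota> i) 1)"
  have "(Q ** transpose Q) $ i $ j = Q $ i \<bullet> Q $ j" for i j
    by (simp add: matrix_matrix_mult_def transpose_def inner_vec_def)
  then have Q: "Q ** transpose Q = mat 1"
    using \<iota> by (simp add: vec_eq_iff Q_def inner_axis_axis mat_def inj_eq)
  interpret stiefel_point Q by unfold_locales (rule Q)
  \<comment> \<open>Each of \<open>Q P^T\<close> and \<open>P Q^T\<close> equals
    \<open>k / 2\<close>, by symmetry of \<open>k\<close>.\<close>
  have "(Q, (1/2) *\<^sub>R (k ** Q)) \<in> W_space k"
    using k by (simp add: W_space_def Q matrix_algebra Q0_cancel flip: scaleR_add_left)
  then show ?thesis by blast
qed

subsection \<open>Tangent spaces\<close>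

lemma has_vector_derivative_of_const_near:
  fixes f :: "real \<Rightarrow> 'a::real_normed_vector"
  assumes "(f has_vector_derivative d) (at 0)" "e > 0" "\<And>t. t \<in> {-e<..<e} \<Longrightarrow> f t = c"
  shows "d = 0"
proof -
  have "(f has_vector_derivative 0) (at 0)"
    by (rule has_vector_derivative_transform_within_open[OF has_vector_derivative_const,
          where S = "{-e<..<e}"]) (use assms(2,3) in auto)
  then show ?thesis using assms(1) vector_derivative_unique_at by blast
qed

lemmas has_vector_derivative_matrix_mul =
  bounded_bilinear.has_vector_derivative[OF bounded_bilinear_matrix_mul]
lemmas has_vector_derivative_transpose =
  bounded_linear.has_vector_derivative[OF bounded_linear_transpose]

text \<open>Both constraints are constant along a curve in the set, so their derivatives at 0, given
  by the product rule, vanish.\<close>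

lemma tangent_space_W_space_subset:
  assumes "v \<in> tangent_space (W_space k) p"
  shows "v \<in> W_kernel p"
proof -
  obtain c e where e: "e > 0" and c: "c ` {-e<..<e} \<subseteq> W_space k" and c0: "c 0 = p"
    and D: "(c has_vector_derivative v) (at 0)"
    using assms unfolding tangent_space_def by blast
  have Q: "((\<lambda>t. fst (c t)) has_vector_derivative fst v) (at 0)"
    and P: "((\<lambda>t. snd (c t)) has_vector_derivative snd v) (at 0)"
    using bounded_linear.has_vector_derivative[OF bounded_linear_fst D]
      bounded_linear.has_vector_derivative[OF bounded_linear_snd D] .
  have S: "c t \<in> W_space k" if "t \<in> {-e<..<e}" for t
    using c that by blast
  have "fst (c 0) ** transpose (fst v) + fst v ** transpose (fst (c 0)) = 0"
    by (rule has_vector_derivative_of_const_near[OF has_vector_derivative_matrix_mul[OF Q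
            has_vector_derivative_transpose[OF Q]] e, where c = "mat 1"])
      (use S in \<open>force simp: W_space_def\<close>)
  moreover have "fst (c 0) ** transpose (snd v) + fst v ** transpose (snd (c 0))
      + (snd (c 0) ** transpose (fst v) + snd v ** transpose (fst (c 0))) = 0"
    by (rule has_vector_derivative_of_const_near[OF has_vector_derivative_add[OF
            has_vector_derivative_matrix_mul[OF Q has_vector_derivative_transpose[OF P]]
            has_vector_derivative_matrix_mul[OF P has_vector_derivative_transpose[OF Q]]] e,
          where c = k])
      (use S in \<open>force simp: W_space_def\<close>)
  ultimately show ?thesis
    by (simp add: W_kernel_def c0 add_ac)
qed

text \<open>If \<open>x = t K x\<close> with \<open>K\<close> skew, then
  \<open>x \<bullet> x\<close> is \<open>t\<close> times \<open>x \<bullet> K x\<close>, which is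
  0.\<close>

lemma det_nonzero_of_skew:
  fixes K :: "real^'n^'n"
  assumes K: "transpose K = - K"
  shows "det (mat 1 - t *\<^sub>R K) \<noteq> 0"
proof -
  have "x = 0" if x: "(mat 1 - t *\<^sub>R K) *v x = 0" for x
  proof -
    have "x \<bullet> (K *v x) = (transpose K *v x) \<bullet> x"
      by (metis dot_lmul_matrix transpose_matrix_vector inner_commute)
    also have "\<dots> = - (x \<bullet> (K *v x))"
      using matrix_vector_mult_diff_rdistrib[of 0 K x]
      by (simp add: K inner_commute)
    finally have "x \<bullet> (K *v x) = 0" by simp
    moreover have "x = t *\<^sub>R (K *v x)"
      using x by (simp add: matrix_vector_mult_diff_rdistrib scaleR_matrix_vector_assoc)
    ultimately have "x \<bullet> x = 0" by (metis inner_scaleR_right mult_zero_right)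
    then show ?thesis by simp
  qed
  then show ?thesis
    by (simp add: matrix_left_invertible_ker invertible_left_inverse flip: invertible_det_nz)
qed

text \<open>The classical Cayley transform \<open>(1 - t K)^-1 (1 + t K)\<close>; skewness of
  \<open>K\<close> makes it orthogonal and defined for every \<open>t\<close>.\<close>

lemma cayley_curve:
  fixes K :: "real^'n^'n"
  assumes K: "transpose K = - K"
  obtains R where "\<And>U. open U \<Longrightarrow> smooth_on U R" "\<And>t. R t ** transpose (R t) = mat 1" "R 0 = mat 1"
    "(R has_vector_derivative 2 *\<^sub>R K) (at (0::real))"
proof
  let ?M = "\<lambda>t. mat 1 - t *\<^sub>R K" and ?N = "\<lambda>t. mat 1 + t *\<^sub>R K"
  let ?R = "\<lambda>t. matrix_inv (?M t) ** ?N t"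
  note nz = det_nonzero_of_skew[OF K]
  show s: "smooth_on U ?R" if "open U" for U
    by (intro smooth_on_intros that nz)
  show R0: "?R 0 = mat 1"
    using matrix_inv_mul(2)[OF nz[of 0]] by simp
  show "?R t ** transpose (?R t) = mat 1" for t
  proof -
    have T: "transpose (?N t) = ?M t" "?N t = transpose (?M t)"
      by (simp_all add: matrix_algebra K)
    have "?R t ** transpose (?R t) = matrix_inv (?M t) ** (?N t ** ?M t) ** transpose (matrix_inv (?M t))"
      by (simp only: matrix_transpose_mul T(1) matrix_mul_assoc)
    \<comment> \<open>The two factors commute, being polynomials in the same matrix.\<close>
    also have "(mat 1 + J) ** (mat 1 - J) = (mat 1 - J) ** (mat 1 + J)" for J :: "real^'n^'n"
      by (simp add: matrix_mul.add_left matrix_mul.add_right matrix_mul.diff_left matrix_mul.diff_right)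
    also have "matrix_inv (?M t) ** (?M t ** ?N t) = ?N t"
      by (simp add: matrix_mul_assoc matrix_inv_mul[OF nz])
    also have "?N t ** transpose (matrix_inv (?M t)) = transpose (matrix_inv (?M t) ** ?M t)"
      unfolding T(2) by (rule matrix_transpose_mul[symmetric])
    finally show ?thesis by (simp add: matrix_inv_mul[OF nz])
  qed
  \<comment> \<open>Smoothness gives existence of the derivative. Its value comes from
    differentiating \<open>(1 - t K) R(t) = 1 + t K\<close> at 0, without differentiating the
    inverse.\<close>
  obtain D where D: "(?R has_vector_derivative D) (at 0)"
    using smooth_on_imp_differentiable[OF s[OF open_UNIV], of 0] vector_derivative_works by blast
  have M: "(?M has_vector_derivative - K) (at 0)"
    by (auto intro!: derivative_eq_intros)
  have N: "(?N has_vector_derivative K) (at 0)"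
    by (auto intro!: derivative_eq_intros)
  have "((\<lambda>t. ?M t ** ?R t) has_vector_derivative ?M 0 ** D + (- K) ** ?R 0) (at 0)"
    by (rule has_vector_derivative_matrix_mul[OF M D])
  moreover have "(\<lambda>t. ?M t ** ?R t) = ?N"
    by (simp add: matrix_mul_assoc matrix_inv_mul[OF nz])
  ultimately have "?M 0 ** D + (- K) ** ?R 0 = K"
    using vector_derivative_unique_at[OF _ N] by simp
  then have "D = 2 *\<^sub>R K" unfolding R0 by (simp add: scaleR_2 diff_eq_eq)
  then show "(?R has_vector_derivative 2 *\<^sub>R K) (at 0)" using D by simp
qed

text \<open>The curve \<open>(Q R(t), (P + t B') R(t))\<close> with \<open>R'(0) = K\<close> has
  velocity \<open>(Q K, P K + B')\<close>, which is to equal \<open>(A, B)\<close>.\<close>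

lemma tangent_space_W_space_superset:
  fixes Q P A B :: "real^'m^'n"
  assumes S: "(Q, P) \<in> W_space k" and T: "(A, B) \<in> W_kernel (Q, P)"
  shows "(A, B) \<in> tangent_space (W_space k) (Q, P)"
proof -
  interpret stiefel_point Q using S by unfold_locales (simp add: W_space_def)
  have k: "Q ** transpose P + P ** transpose Q = k" using S by (simp add: W_space_def)
  have T1: "Q ** transpose A = - (A ** transpose Q)"
    and T2: "A ** transpose P + P ** transpose A + B ** transpose Q + Q ** transpose B = 0"
    using T by (auto simp: W_kernel_def eq_neg_iff_add_eq_0 add.commute)
  define b where "b = normal_part A"
  \<comment> \<open>A skew matrix with \<open>Q K = A\<close>: the other terms are forced by skewness and vanish under \<open>Q\<close>.\<close>
  define K where "K = transpose Q ** (A ** transpose Q) ** Q + transpose Q ** b - transpose b ** Q"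
  have "Q ** transpose b = transpose (b ** transpose Q)"
    by (simp add: matrix_transpose_mul)
  then have b: "Q ** transpose b = 0"
    by (simp add: b_def normal_part_Q0 linear_0[OF linear_transpose])
  have K: "transpose K = - K"
    unfolding K_def by (simp add: matrix_algebra T1)
  have QK: "Q ** K = A"
    unfolding K_def
    by (simp add: matrix_mul.add_right matrix_mul.diff_right matrix_mul_assoc Q0 b matrix_mul.zero_left)
      (simp add: b_def normal_part_def)
  \<comment> \<open>Forced by the velocity. With \<open>Q K = A\<close>, the second linearized
    constraint becomes \<open>Q B'^T + B' Q^T = 0\<close>, so the line \<open>P + t B'\<close>
    satisfies the second constraint for all \<open>t\<close>.\<close>
  define B' where "B' = B - P ** K"
  have "P ** K ** transpose Q = - (P ** transpose (Q ** K))"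
    "Q ** transpose (P ** K) = - (Q ** K ** transpose P)"
    by (simp_all add: matrix_transpose_mul K matrix_mul.minus_left matrix_mul.minus_right matrix_mul_assoc)
  then have B': "Q ** transpose B' + B' ** transpose Q = 0"
    using T2 by (simp add: B'_def matrix_mul.diff_left matrix_mul.diff_right
        linear_diff[OF linear_transpose] QK algebra_simps)
  \<comment> \<open>Halved because the Cayley curve of a matrix has twice that matrix as its
    velocity.\<close>
  have "transpose ((1/2) *\<^sub>R K) = - ((1/2) *\<^sub>R K)"
    by (simp add: K matrix_algebra)
  then obtain R where R: "\<And>U. open U \<Longrightarrow> smooth_on U R" "\<And>t. R t ** transpose (R t) = mat 1" "R 0 = mat 1"
    "(R has_vector_derivative 2 *\<^sub>R ((1/2) *\<^sub>R K)) (at (0::real))"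
    by (rule cayley_curve) blast
  then have RD: "(R has_vector_derivative K) (at 0)" by simp
  let ?c = "\<lambda>t. (Q ** R t, (P + t *\<^sub>R B') ** R t)"
  \<comment> \<open>A common orthogonal right factor cancels in every product \<open>X Y^T\<close>,
    so it preserves both constraints.\<close>
  have orth: "X ** R t ** transpose (Y ** R t) = X ** transpose Y" for X Y :: "real^'m^'n" and t
    by (simp add: matrix_transpose_mul R(2) flip: matrix_mul_assoc)
      (simp add: matrix_mul_assoc R(2))
  have "smooth_on {-1<..<1} ?c"
    by (intro smooth_on_intros R(1)) auto
  moreover have "?c t \<in> W_space k" for t
  proof -
    have "Q ** transpose (P + t *\<^sub>R B') + (P + t *\<^sub>R B') ** transpose Q
        = k + t *\<^sub>R (Q ** transpose B' + B' ** transpose Q)"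
      by (simp add: matrix_algebra scaleR_add_right flip: k)
    then show ?thesis by (simp add: W_space_def orth Q0 B')
  qed
  moreover have "(?c has_vector_derivative (A, B)) (at 0)"
  proof (rule has_vector_derivative_Pair)
    show "((\<lambda>t. Q ** R t) has_vector_derivative A) (at 0)"
      using has_vector_derivative_matrix_mul[OF has_vector_derivative_const RD, of Q]
      by (simp add: QK matrix_mul.zero_left)
    have "((\<lambda>t. P + t *\<^sub>R B') has_vector_derivative B') (at 0)"
      by (auto intro!: derivative_eq_intros)
    from has_vector_derivative_matrix_mul[OF this RD]
    show "((\<lambda>t. (P + t *\<^sub>R B') ** R t) has_vector_derivative B) (at 0)"
      by (simp add: R(3) B'_def)
  qed
  ultimately show ?thesis
    unfolding tangent_space_def
    by (intro CollectI exI[of _ ?c] exI[of _ "1::real"]) (auto simp: R(3))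
qed

theorem theorem3:
  fixes k :: "real^'n::finite^'n"
  assumes "CARD('n) \<le> CARD('m::finite)"
    and "transpose k = k"
  shows "symplectic_submanifold omega (W_space k :: ((real^'m^'n) \<times> (real^'m^'n)) set)"
  unfolding symplectic_submanifold_def
proof (intro conjI ballI)
  show "symplectic_form (omega :: (real^'m^'n) \<times> (real^'m^'n) \<Rightarrow> _)"
    by (rule symplectic_form_omega)
  show "\<exists>d. smooth_submanifold d (W_space k :: ((real^'m^'n) \<times> (real^'m^'n)) set)"
    by (rule smooth_submanifold_W_space[OF assms(2) W_space_nonempty[OF assms]])
next
  fix p :: "(real^'m^'n) \<times> (real^'m^'n)" assume p: "p \<in> W_space k"
  obtain Q P where QP: "p = (Q, P)" by fastforce
  have "tangent_space (W_space k) p = W_kernel p"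
    using tangent_space_W_space_subset tangent_space_W_space_superset p unfolding QP by fastforce
  then show "nondegenerate_on (tangent_space (W_space k) p) omega"
    using nondegenerate_W_kernel[of Q P] p by (simp add: QP W_space_def)
qed

end
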